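(* Let $\mathcal{G}$ denote the class of all graphs of order at least $2$ with no isolated vertex. Then \[ \sup_{G \in \mathcal{G}} \frac{\gamma_g(G)}{\Psi_g^+(G)} \ge \frac{11}{10}. \]
   Context: All graphs are finite and simple. A vertex dominates itself and its neighbors. In the domination game on $G$, two players, Dominator and Staller, alternately choose vertices of $G$, each chosen vertex being required to dominate at least one vertex not dominated by the previously chosen vertices; the game ends when the chosen vertices form a dominating set. Dominator aims to minimize and Staller to maximize the number of moves; $\gamma_g(G)$ is the number of moves when Dominator moves first and both play optimally. For a set $S$ of vertices, a vertex $v\in S$ is an enclave of $S$ if $N[v] \subseteq S$; $S$ is enclaveless if it contains no enclave. In the competition-enclaveless game, Maximizer and Minimizer alternately choose a vertex $v$ not in the set $S$ of previously chosen vertices such that $S\cup\{v\}$ is enclaveless, until no such vertex exists; Maximizer aims to maximize and Minimizer to minimize the final $|S|$. $\Psi_g^+(G)$ is the final $|S|$ when Maximizer moves first and both play optimally. *)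

theory Defs
  imports "HOL-Library.Extended_Real" "Graph_Theory.Pair_Digraph"
begin

text \<open>
  Finite simple graphs are the \<open>pair_graph\<close>s: finite, loop-free, symmetric, without parallel arcs.
\<close>

definition closed_nbhd :: "'a pair_pre_digraph \<Rightarrow> 'a \<Rightarrow> 'a set" where
  "closed_nbhd G v = insert v {u. (v, u) \<in> parcs G}"

definition isolated_vertex :: "'a pair_pre_digraph \<Rightarrow> 'a \<Rightarrow> bool" where
  "isolated_vertex G v \<longleftrightarrow> v \<in> pverts G \<and> (\<nexists>u. (v, u) \<in> parcs G)"

definition dominated :: "'a pair_pre_digraph \<Rightarrow> 'a set \<Rightarrow> 'a set" where
  "dominated G S = (\<Union>v\<in>S. closed_nbhd G v)"

definition dominating_set :: "'a pair_pre_digraph \<Rightarrow> 'a set \<Rightarrow> bool" where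
  "dominating_set G S \<longleftrightarrow> S \<subseteq> pverts G \<and> pverts G \<subseteq> dominated G S"

definition enclave :: "'a pair_pre_digraph \<Rightarrow> 'a set \<Rightarrow> 'a \<Rightarrow> bool" where
  "enclave G S v \<longleftrightarrow> v \<in> S \<and> closed_nbhd G v \<subseteq> S"

definition enclaveless :: "'a pair_pre_digraph \<Rightarrow> 'a set \<Rightarrow> bool" where
  "enclaveless G S \<longleftrightarrow> (\<nexists>v. enclave G S v)"

datatype player = Minimizing | Maximizing

fun opponent :: "player \<Rightarrow> player" where
  "opponent Minimizing = Maximizing"
| "opponent Maximizing = Minimizing"

fun optimum :: "player \<Rightarrow> nat set \<Rightarrow> nat" where
  "optimum Minimizing A = Min A"
| "optimum Maximizing A = Max A"

definition moves :: "'a set \<Rightarrow> ('a set \<Rightarrow> 'a \<Rightarrow> bool) \<Rightarrow> 'a set \<Rightarrow> 'a set" where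
  "moves V legal S = {v \<in> V - S. legal S v}"

text \<open>
  The number of vertices chosen at the end of the game under optimal play, when \<open>S\<close> is the set of
  vertices chosen so far and player \<open>p\<close> is to move. The case of infinite \<open>V\<close> only serves to make
  the recursion total.
\<close>

function game_value :: "'a set \<Rightarrow> ('a set \<Rightarrow> 'a \<Rightarrow> bool) \<Rightarrow> player \<Rightarrow> 'a set \<Rightarrow> nat" where
  "game_value V legal p S =
     (if infinite V \<or> moves V legal S = {} then card S
      else optimum p ((\<lambda>v. game_value V legal (opponent p) (insert v S)) ` moves V legal S))"
  by pat_completeness auto
termination
proof (relation "measure (\<lambda>(V, legal, p, S). card (V - S))", goal_cases)
  case (2 V legal p S v)
  then have "finite V" "v \<in> V - S"
    by (auto simp: moves_def)
  then have "card (V - insert v S) < card (V - S)"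
    by (intro psubset_card_mono) auto
  then show ?case
    by simp
qed simp

declare game_value.simps [simp del]

text \<open>
  In both games every move chooses a new vertex, so the number of moves is the final number of
  chosen vertices. In the domination game a previously chosen vertex is never playable again, and
  the players run out of moves exactly when the chosen vertices form a dominating set
  (\<open>domination_game_over_iff\<close> below).
\<close>

definition domination_legal :: "'a pair_pre_digraph \<Rightarrow> 'a set \<Rightarrow> 'a \<Rightarrow> bool" where
  "domination_legal G S v \<longleftrightarrow> \<not> closed_nbhd G v \<subseteq> dominated G S"

definition enclaveless_legal :: "'a pair_pre_digraph \<Rightarrow> 'a set \<Rightarrow> 'a \<Rightarrow> bool" where
  "enclaveless_legal G S v \<longleftrightarrow> enclaveless G (insert v S)"

definition game_domination_number :: "'a pair_pre_digraph \<Rightarrow> nat" ("\<gamma>\<^sub>g") where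
  "\<gamma>\<^sub>g G = game_value (pverts G) (domination_legal G) Minimizing {}"

definition max_start_enclaveless_number :: "'a pair_pre_digraph \<Rightarrow> nat" ("\<Psi>\<^sub>g\<^sup>+") where
  "\<Psi>\<^sub>g\<^sup>+ G = game_value (pverts G) (enclaveless_legal G) Maximizing {}"

lemma domination_legal_imp_notin: "domination_legal G S v \<Longrightarrow> v \<notin> S"
  by (auto simp: domination_legal_def dominated_def)

lemma domination_game_over_iff:
  assumes "pair_graph G" and "S \<subseteq> pverts G"
  shows "moves (pverts G) (domination_legal G) S = {} \<longleftrightarrow> dominating_set G S"
proof -
  interpret pair_graph G by fact
  have sub: "closed_nbhd G v \<subseteq> pverts G" if "v \<in> pverts G" for v
    using that by (auto simp: closed_nbhd_def dest: in_arcsD2)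
  have self: "v \<in> closed_nbhd G v" for v
    by (simp add: closed_nbhd_def)
  have "moves (pverts G) (domination_legal G) S = {v \<in> pverts G. domination_legal G S v}"
    by (auto simp: moves_def dest: domination_legal_imp_notin)
  then show ?thesis
    using assms(2) sub self unfolding dominating_set_def domination_legal_def by blast
qed

text \<open>
  The class of finite simple graphs of order at least 2 without isolated vertices; every such graph
  is isomorphic to one with vertices in \<^typ>\<open>nat\<close>.
\<close>

definition isolate_free_graphs :: "nat pair_pre_digraph set" where
  "isolate_free_graphs =
     {G. pair_graph G \<and> card (pverts G) \<ge> 2 \<and> (\<nexists>v. isolated_vertex G v)}"

text \<open>
  On this class the denominator of \<open>\<gamma>\<^sub>g G / \<Psi>\<^sub>g\<^sup>+ G\<close> does not vanish.
\<close>

lemma game_value_ge: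
  assumes "finite S"
  shows "card S \<le> game_value V legal p S"
  using assms
proof (induction V legal p S rule: game_value.induct)
  case (1 V legal p S)
  show ?case
  proof (cases "infinite V \<or> moves V legal S = {}")
    case True
    then show ?thesis by (subst game_value.simps) simp
  next
    case False
    have "card S \<le> game_value V legal (opponent p) (insert v S)" if "v \<in> moves V legal S" for v
      using 1 False that by (meson card_insert_le finite.insertI le_trans)
    moreover have "finite (moves V legal S)"
      using False by (auto simp: moves_def)
    ultimately show ?thesis
      using False by (subst game_value.simps, cases p) (auto simp: Max_ge_iff)
  qed
qed

lemma max_start_enclaveless_number_pos:
  assumes "G \<in> isolate_free_graphs"
  shows "\<Psi>\<^sub>g\<^sup>+ G > 0"
proof -
  interpret pair_graph G using assms by (simp add: isolate_free_graphs_def)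
  let ?M = "moves (pverts G) (enclaveless_legal G) {}"
  let ?val = "\<lambda>v. game_value (pverts G) (enclaveless_legal G) Minimizing {v}"
  have "enclaveless_legal G {} v" if v: "v \<in> pverts G" for v
  proof -
    obtain u where "(v, u) \<in> parcs G" "u \<noteq> v"
      using assms v pair_no_loops
      unfolding isolate_free_graphs_def isolated_vertex_def by fastforce
    then show ?thesis
      by (auto simp: enclaveless_legal_def enclaveless_def enclave_def closed_nbhd_def)
  qed
  then have M: "?M = pverts G"
    by (auto simp: moves_def)
  have ne: "pverts G \<noteq> {}"
    using assms by (auto simp: isolate_free_graphs_def)
  then obtain v where v: "v \<in> pverts G" by blast
  have "\<Psi>\<^sub>g\<^sup>+ G = Max (?val ` pverts G)"
    unfolding max_start_enclaveless_number_def
    by (subst game_value.simps) (simp add: M ne pair_finite_verts)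
  moreover have "?val v \<le> Max (?val ` pverts G)"
    using v pair_finite_verts by simp
  moreover have "1 \<le> ?val v"
    using game_value_ge[of "{v}"] by simp
  ultimately show ?thesis by linarith
qed

end

theory Submission
  imports Defs
begin

text \<open>
  Let every leaf of a graph on \<open>2k\<close> vertices be matched with its support vertex, and let these \<open>k\<close>
  pairs cover all vertices (a corona). An enclaveless set contains at most one vertex of each pair,
  so \<open>\<Psi>\<^sub>g\<^sup>+ \<le> k\<close>. A dominating set contains at least one vertex of each pair, so
  \<open>\<gamma>\<^sub>g \<ge> k + 1\<close> as soon as Staller can ensure that both vertices of some pair are chosen.
  In two disjoint copies of the corona of the path with three vertices (so \<open>k = 6\<close>), Staller answers
  Dominator's first move by choosing the leaf at the centre of the other copy. The two further
  neighbours of that centre have only the centre as common dominator, so either Dominator chooses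
  the centre next, or one of these neighbours stays undominated and Staller can choose the centre.
\<close>

section \<open>Values of finite games\<close>

text \<open>Optima over finite nonempty move sets are attained, so some line of play ends in a
  position whose cardinality is the value. The invariant \<open>I\<close> carries a property of the
  start along it.\<close>

lemma game_value_eq_card_terminal:
  assumes "finite V" and "I S"
    and "\<And>S v. I S \<Longrightarrow> v \<in> moves V legal S \<Longrightarrow> I (insert v S)"
  shows "\<exists>T. S \<subseteq> T \<and> I T \<and> moves V legal T = {} \<and> game_value V legal p S = card T"
  using assms
proof (induction V legal p S rule: game_value.induct)
  case (1 V legal p S)
  show ?case
  proof (cases "moves V legal S = {}")
    case True
    then show ?thesis using 1 by (subst game_value.simps) auto
  next
    case False
    let ?A = "(\<lambda>v. game_value V legal (opponent p) (insert v S)) ` moves V legal S"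
    have "finite ?A"
      using 1 by (simp add: moves_def)
    then have "optimum p ?A \<in> ?A"
      using False Min_in[of ?A] Max_in[of ?A] by (cases p) simp_all
    moreover have "game_value V legal p S = optimum p ?A"
      using 1 False by (subst game_value.simps) simp
    ultimately obtain v where v: "v \<in> moves V legal S"
      "game_value V legal p S = game_value V legal (opponent p) (insert v S)"
      by auto
    with 1 False show ?thesis
      by (metis insert_subset)
  qed
qed

text \<open>Existence of a move matters: in a terminal position the last premise is vacuous, and the
  value is \<open>card S\<close>.\<close>

lemma game_value_Minimizing_geI:
  assumes "finite V" and "moves V legal S \<noteq> {}"
    and "\<And>v. v \<in> moves V legal S \<Longrightarrow> k \<le> game_value V legal Maximizing (insert v S)"
  shows "k \<le> game_value V legal Minimizing S"
proof -
  have "finite (moves V legal S)"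
    using assms(1) by (simp add: moves_def)
  with assms show ?thesis
    by (subst game_value.simps) simp
qed

lemma game_value_Maximizing_geI:
  assumes "finite V" and "v \<in> moves V legal S"
    and "k \<le> game_value V legal Minimizing (insert v S)"
  shows "k \<le> game_value V legal Maximizing S"
proof -
  have "finite (moves V legal S)"
    using assms(1) by (simp add: moves_def)
  then have "game_value V legal Minimizing (insert v S) \<le> game_value V legal Maximizing S"
    using assms(1,2) by (subst (2) game_value.simps) auto
  with assms(3) show ?thesis by simp
qed

section \<open>The graph and its pairs\<close>

text \<open>
  The pairs are \<open>{2 * i, 2 * i + 1}\<close> with leaf \<open>2 * i + 1\<close>; the two copies are \<open>{0..5}\<close> and
  \<open>{6..11}\<close>, with centres \<open>0\<close> and \<open>6\<close>.
\<close>

definition two_P3_coronas :: "nat pair_pre_digraph" where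
  "two_P3_coronas =
     (let A = {(0,1), (0,2), (0,4), (2,3), (4,5), (6,7), (6,8), (6,10), (8,9), (10,11)}
      in \<lparr> pverts = {..<12}, parcs = A \<union> A\<inverse> \<rparr>)"

lemma pverts_two_P3_coronas [simp]: "pverts two_P3_coronas = {..<12}"
  by (simp add: two_P3_coronas_def Let_def)

lemma mem_parcs_two_P3_coronas:
  "(u, v) \<in> parcs two_P3_coronas \<longleftrightarrow>
     (let A = {(0,1), (0,2), (0,4), (2,3), (4,5), (6,7), (6,8), (6,10), (8,9), (10,11)}
      in (u, v) \<in> A \<or> (v, u) \<in> A)"
  by (simp add: two_P3_coronas_def Let_def)

lemma sym_parcs_two_P3_coronas: "sym (parcs two_P3_coronas)"
proof (rule symI)
  fix u v assume "(u, v) \<in> parcs two_P3_coronas"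
  then show "(v, u) \<in> parcs two_P3_coronas"
    unfolding mem_parcs_two_P3_coronas Let_def by (simp only: disj_commute)
qed

lemma pair_graph_two_P3_coronas: "pair_graph two_P3_coronas"
proof
  show "symmetric two_P3_coronas"
    using sym_parcs_two_P3_coronas by (simp add: symmetric_def)
  show "finite (parcs two_P3_coronas)"
    by (simp add: two_P3_coronas_def Let_def)
  fix e assume "e \<in> parcs two_P3_coronas"
  then show "fst e \<in> pverts two_P3_coronas" "snd e \<in> pverts two_P3_coronas" "fst e \<noteq> snd e"
    by (cases e; force simp: mem_parcs_two_P3_coronas)+
qed simp

lemma two_P3_coronas_isolate_free: "two_P3_coronas \<in> isolate_free_graphs"
proof -
  have "\<exists>u. (v, u) \<in> parcs two_P3_coronas" if "v < 12" for v
  proof -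
    have "v \<in> {0, 1, 2, 3, 4, 5, 6, 7, 8, 9, 10, 11}"
      using that by (simp add: eval_nat_numeral less_Suc_eq)
    then show ?thesis
      by (elim insertE emptyE; simp add: mem_parcs_two_P3_coronas; blast)
  qed
  then show ?thesis
    by (simp add: isolate_free_graphs_def isolated_vertex_def pair_graph_two_P3_coronas)
qed

text \<open>Both counting arguments rest on this: a fully chosen pair has an enclave, and an
  untouched pair has an undominated leaf.\<close>

lemma closed_nbhd_leaf:
  assumes "i < 6"
  shows "closed_nbhd two_P3_coronas (2 * i + 1) = {2 * i, 2 * i + 1}"
proof -
  have "i \<in> {0, 1, 2, 3, 4, 5}"
    using assms by (simp add: eval_nat_numeral less_Suc_eq)
  then show ?thesis
    by (elim insertE emptyE; simp add: closed_nbhd_def mem_parcs_two_P3_coronas set_eq_iff; blast)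
qed

text \<open>No edge joins the copies, so Dominator's first move dominates nothing in the other
  one.\<close>

lemma closed_nbhd_same_copy:
  "v \<in> closed_nbhd two_P3_coronas u \<Longrightarrow> v < 6 \<longleftrightarrow> u < 6"
  by (auto simp: closed_nbhd_def mem_parcs_two_P3_coronas)

section \<open>Upper bound in the enclaveless game\<close>

text \<open>The pair index \<open>v div 2\<close> is injective on \<open>T\<close>, and there are
  six pairs.\<close>

lemma card_enclaveless_le:
  assumes "T \<subseteq> {..<12}" and "enclaveless two_P3_coronas T"
  shows "card T \<le> 6"
proof -
  have not_both: "\<not> (2 * i \<in> T \<and> 2 * i + 1 \<in> T)" if "i < 6" for i
    using assms(2) closed_nbhd_leaf[OF that] by (auto simp: enclaveless_def enclave_def)
  have "inj_on (\<lambda>v. v div 2) T"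
  proof (rule inj_onI, rule ccontr)
    fix u v assume uv: "u \<in> T" "v \<in> T" "u div 2 = v div 2" "u \<noteq> v"
    then have "u div 2 < 6" using assms(1) by auto
    moreover have "u = 2 * (u div 2) \<and> v = 2 * (u div 2) + 1 \<or>
        v = 2 * (u div 2) \<and> u = 2 * (u div 2) + 1"
      using uv(3,4) by linarith
    ultimately show False
      using uv(1,2) not_both by metis
  qed
  moreover have "(\<lambda>v. v div 2) ` T \<subseteq> {..<6}"
    using assms(1) by auto
  ultimately show ?thesis
    using card_inj_on_le[of "\<lambda>v. v div 2" T "{..<6}"] by simp
qed

lemma enclaveless_number_two_P3_coronas: "\<Psi>\<^sub>g\<^sup>+ two_P3_coronas \<le> 6"
proof -
  let ?I = "\<lambda>S. S \<subseteq> {..<12} \<and> enclaveless two_P3_coronas S"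
  have "?I {}"
    by (simp add: enclaveless_def enclave_def)
  then have "\<exists>T. {} \<subseteq> T \<and> ?I T \<and> moves {..<12} (enclaveless_legal two_P3_coronas) T = {} \<and>
      game_value {..<12} (enclaveless_legal two_P3_coronas) Maximizing {} = card T"
    by (intro game_value_eq_card_terminal) (auto simp: moves_def enclaveless_legal_def)
  then show ?thesis
    using card_enclaveless_le by (auto simp: max_start_enclaveless_number_def)
qed

section \<open>Lower bound in the domination game\<close>

text \<open>Dominating the leaves makes \<open>T\<close> meet every pair, and it still does without
  \<open>2 * i\<close>. So six vertices remain besides \<open>2 * i\<close>.\<close>

lemma card_dominating_ge:
  assumes "T \<subseteq> {..<12}" and "{..<12} \<subseteq> dominated two_P3_coronas T"
    and "i < 6" and "2 * i \<in> T" and "2 * i + 1 \<in> T"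
  shows "7 \<le> card T"
proof -
  have fin: "finite T" using assms(1) finite_subset by blast
  have sym: "u \<in> closed_nbhd two_P3_coronas v \<longleftrightarrow> v \<in> closed_nbhd two_P3_coronas u" for u v
    using sym_parcs_two_P3_coronas by (auto simp: closed_nbhd_def dest: symD)
  have "j \<in> (\<lambda>v. v div 2) ` (T - {2 * i})" if "j < 6" for j
  proof -
    have "2 * j + 1 \<in> dominated two_P3_coronas T" using assms(2) that by auto
    then have "2 * j \<in> T \<or> 2 * j + 1 \<in> T"
      using closed_nbhd_leaf[OF that] by (auto simp: dominated_def sym)
    then have "\<exists>v\<in>T - {2 * i}. j = v div 2"
    proof (cases "j = i")
      case True
      then show ?thesis using assms(5) by (intro bexI[of _ "2 * i + 1"]) auto
    next
      case False
      with \<open>2 * j \<in> T \<or> 2 * j + 1 \<in> T\<close> show ?thesis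
        by (elim disjE) (force intro: bexI[of _ "2 * j"] bexI[of _ "2 * j + 1"])+
    qed
    then show ?thesis by blast
  qed
  then have "{..<6} \<subseteq> (\<lambda>v. v div 2) ` (T - {2 * i})" by auto
  then have "card {..<6::nat} \<le> card (T - {2 * i})"
    using fin by (meson finite_Diff surj_card_le)
  then show ?thesis
    using fin assms(4) card_Suc_Diff1[of T "2 * i"] by simp
qed

abbreviation dom_value :: "player \<Rightarrow> nat set \<Rightarrow> nat" where
  "dom_value \<equiv> game_value {..<12} (domination_legal two_P3_coronas)"

text \<open>Chosen vertices stay chosen and the final set dominates, so the extra vertex is secured
  however play continues.\<close>

lemma dom_value_ge_if_both:
  assumes "S \<subseteq> {..<12}" and "i < 6" and "2 * i \<in> S" and "2 * i + 1 \<in> S"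
  shows "7 \<le> dom_value p S"
proof -
  obtain T where T: "S \<subseteq> T" "T \<subseteq> {..<12}"
    "moves {..<12} (domination_legal two_P3_coronas) T = {}" "dom_value p S = card T"
    using game_value_eq_card_terminal[of "{..<12}" "\<lambda>S. S \<subseteq> {..<12}" S
        "domination_legal two_P3_coronas" p] assms(1)
    by (auto simp: moves_def)
  then have "{..<12} \<subseteq> dominated two_P3_coronas T"
    using domination_game_over_iff[OF pair_graph_two_P3_coronas, of T]
    by (simp add: dominating_set_def)
  then show ?thesis
    using card_dominating_ge[of T i] T assms by auto
qed

lemma domination_legalI:
  assumes "u \<in> closed_nbhd G v" and "u \<notin> dominated G S"
  shows "domination_legal G S v"
  using assms by (auto simp: domination_legal_def)

text \<open>The position after Dominator opens with \<open>x\<close> and Staller answers with the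
  leaf at the centre \<open>c\<close> of the other copy.\<close>

lemma dom_value_ge_after_leaf:
  assumes c: "c = 0 \<or> c = 6" and x: "x < 12" "x < 6 \<longleftrightarrow> \<not> c < 6"
  shows "7 \<le> dom_value Minimizing {c + 1, x}"
proof (rule game_value_Minimizing_geI)
  have i: "c div 2 < 6" "2 * (c div 2) = c" using c by auto
  have nbhd_centre: "closed_nbhd two_P3_coronas c = {c, c + 1, c + 2, c + 4}"
    using c
    by (elim disjE)
      (simp_all add: closed_nbhd_def mem_parcs_two_P3_coronas set_eq_iff numeral_2_eq_2)
  have nbhd_leaf: "closed_nbhd two_P3_coronas (c + 1) = {c, c + 1}"
    using closed_nbhd_leaf[OF i(1)] unfolding i(2) .
  have "c + 2 \<notin> closed_nbhd two_P3_coronas x" "c + 4 \<notin> closed_nbhd two_P3_coronas x"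
    using c x(2) closed_nbhd_same_copy[of _ x] by fastforce+
  then have undom: "c + 2 \<notin> dominated two_P3_coronas {c + 1, x}"
    "c + 4 \<notin> dominated two_P3_coronas {c + 1, x}"
    by (simp_all add: dominated_def nbhd_leaf[simplified])
  have "domination_legal two_P3_coronas {c + 1, x} c"
    using undom by (intro domination_legalI[of "c + 2"]) (auto simp: nbhd_centre)
  then have "c \<in> moves {..<12} (domination_legal two_P3_coronas) {c + 1, x}"
    using c x(2) by (auto simp: moves_def)
  then show "moves {..<12} (domination_legal two_P3_coronas) {c + 1, x} \<noteq> {}"
    by blast
  fix z assume z: "z \<in> moves {..<12} (domination_legal two_P3_coronas) {c + 1, x}"
  have S: "insert z {c + 1, x} \<subseteq> {..<12}" using z c x by (auto simp: moves_def)
  show "7 \<le> dom_value Maximizing (insert z {c + 1, x})"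
  proof (cases "z = c")
    case True
    then show ?thesis
      using dom_value_ge_if_both[OF S i(1)] by (simp add: i(2))
  next
    case False
    \<comment> \<open>Only \<open>c\<close> dominates both \<open>c + 2\<close> and
      \<open>c + 4\<close>. The one that \<open>z\<close> misses keeps \<open>c\<close> legal for
      Staller, who then completes the pair.\<close>
    then have "\<exists>u\<in>{c + 2, c + 4}. u \<notin> closed_nbhd two_P3_coronas z"
      using c by (elim disjE; simp add: closed_nbhd_def mem_parcs_two_P3_coronas; presburger)
    then obtain u where "u \<in> {c + 2, c + 4}" "u \<notin> dominated two_P3_coronas (insert z {c + 1, x})"
      using undom by (auto simp: dominated_def)
    then have "domination_legal two_P3_coronas (insert z {c + 1, x}) c"
      by (intro domination_legalI[of u]) (auto simp: nbhd_centre)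
    then have "c \<in> moves {..<12} (domination_legal two_P3_coronas) (insert z {c + 1, x})"
      using c x(2) False by (auto simp: moves_def)
    moreover have "7 \<le> dom_value Minimizing (insert c (insert z {c + 1, x}))"
      using dom_value_ge_if_both[of "insert c (insert z {c + 1, x})" "c div 2"] S i c by auto
    ultimately show ?thesis
      by (intro game_value_Maximizing_geI) auto
  qed
qed simp

lemma domination_number_two_P3_coronas: "7 \<le> \<gamma>\<^sub>g two_P3_coronas"
proof -
  have "7 \<le> dom_value Minimizing {}"
  proof (rule game_value_Minimizing_geI)
    have "domination_legal two_P3_coronas {} 0"
      by (auto simp: domination_legal_def dominated_def closed_nbhd_def)
    then show "moves {..<12} (domination_legal two_P3_coronas) {} \<noteq> {}"
      by (auto simp: moves_def intro: exI[of _ 0])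
    fix x assume "x \<in> moves {..<12} (domination_legal two_P3_coronas) {}"
    then have x: "x < 12" by (auto simp: moves_def)
    \<comment> \<open>The centre of the copy that \<open>x\<close> avoids.\<close>
    define c :: nat where "c = (if x < 6 then 6 else 0)"
    have c: "c = 0 \<or> c = 6" "x < 6 \<longleftrightarrow> \<not> c < 6"
      by (simp_all add: c_def)
    then have "c + 1 \<notin> dominated two_P3_coronas {x}"
      using closed_nbhd_same_copy[of "c + 1" x] by (auto simp: dominated_def)
    then have "domination_legal two_P3_coronas {x} (c + 1)"
      by (intro domination_legalI[of "c + 1"]) (auto simp: closed_nbhd_def)
    then have "c + 1 \<in> moves {..<12} (domination_legal two_P3_coronas) {x}"
      using c by (auto simp: moves_def)
    then show "7 \<le> dom_value Maximizing {x}"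
      using dom_value_ge_after_leaf[OF c(1) x c(2)] by (intro game_value_Maximizing_geI) auto
  qed simp
  then show ?thesis by (simp add: game_domination_number_def)
qed

theorem theorem2p4:
  shows "(SUP G \<in> isolate_free_graphs. ereal (real (\<gamma>\<^sub>g G) / real (\<Psi>\<^sub>g\<^sup>+ G))) \<ge> ereal (11 / 10)"
proof (rule SUP_upper2[OF two_P3_coronas_isolate_free])
  let ?g = "real (\<gamma>\<^sub>g two_P3_coronas)" and ?p = "real (\<Psi>\<^sub>g\<^sup>+ two_P3_coronas)"
  \<comment> \<open>The ratio is at least 7/6, which exceeds 11/10. Positivity of \<open>?p\<close>
    matters, since division by zero would give 0.\<close>
  have "0 < ?p" "?p \<le> 6" "7 \<le> ?g"
    using max_start_enclaveless_number_pos[OF two_P3_coronas_isolate_free]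
      enclaveless_number_two_P3_coronas domination_number_two_P3_coronas by simp_all
  then have "11 / 10 \<le> ?g / ?p" by (simp add: field_simps)
  then show "ereal (11 / 10) \<le> ereal (?g / ?p)" by simp
qed

end
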